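(* Let $\psi_0\in F$ be a fixed reference field, let $m,n\in\mathbb{N}_0$ be large enough indices such that the regularized master Dyson--Schwinger operator is a Hilbert--Schmidt operator $\mathbf{M}_{\psi_0}: H_m\otimes_{\mathrm{HS}}F_n\to H_0$, and let $\hat{\mathbf{M}}^2_{\psi_0}:H_m\to H_m$ be the associated positive trace class operator (all as defined in the context). Let $P$ denote the orthogonal projection in $H_m$ onto $\mathrm{Ker}(\hat{\mathbf{M}}^2_{\psi_0})$. Then the following statements are equivalent. (i) The solution space of the regularized MDS equation in $H_m$ is not empty, i.e. there exists $G\in H_m$ with $b\,G=1$ and $\mathbf{M}_{\psi_0}(G\otimes\delta\psi_T)=0$ for all $\delta\psi_T\in\mathbb{F}_T$. (ii) $P\mathbf{1}\neq 0$. (iii) $b\,P\mathbf{1}\neq 0$.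
   Context: **Fields.** $\mathcal{M}$ is a compact finite dimensional smooth oriented manifold, with or without boundary (if there is a boundary, it has the cone property). $F$ is the affine space of smooth sections of a real finite dimensional affine bundle over $\mathcal{M}$; $\mathbb{F}$ is the real vector space of smooth sections of the subordinate vector bundle, with its $C^\infty$ topology (a nuclear Fréchet space). $\mathbb{F}_T\subset\mathbb{F}$ is either $\mathbb{F}$ itself or the closed subspace of sections vanishing on $\partial\mathcal{M}$ together with all derivatives. There is a real-complex splitting $\mathbb{F}=\mathbb{F}_r\oplus\mathbb{F}_c$ into closed subspaces with $\mathbb{F}_c$ carrying a complex structure; $\mathbb{F}_{(\mathbb{C})}:=(\mathbb{F}_r\otimes\mathbb{C})\oplus\mathbb{F}_c$, which contains $\mathbb{F}$ as a real subspace. There is a splitting $\mathbb{F}=\bigoplus_{i=1}^f\mathbb{F}_i$ into closed flavor sectors, each contained in $\mathbb{F}_r$ or in $\mathbb{F}_c$, with labels $s_i\in\{0,1\}$ (bosonic/fermionic). $\mathbb{F}_T$ respects these splittings. **Field algebra.** Both $\mathbb{F}_{(\mathbb{C})}$ and $\mathbb{F}_T$ are countably Hilbert nuclear Fréchet spaces: their topologies are defined by sequences $\|\cdot\|_0,\|\cdot\|_1,\dots$, respectively $\|\cdot\|^F_0,\|\cdot\|^F_1,\dots$, of increasing Hilbertian norms of Sobolev type, such that the completions are nested in each other and the inclusions between distant enough completions are Hilbert--Schmidt (and eventually nuclear). $F_n$ denotes the Hilbert space completion of $\mathbb{F}_T$ in $\|\cdot\|^F_n$. The analytic tensor algebra $\mathcal{T}_h(\mathbb{F}_{(\mathbb{C})})$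 is the space of sequences $G=(G^{(0)},G^{(1)},\dots)$ with $G^{(n)}\in\bigotimes^n\mathbb{F}_{(\mathbb{C})}$ (completed tensor products) for which all of the norms $\|G\|_m:=\big(\sum_{n\ge0}2^{mn}(\|G^{(n)}\|_m^{\otimes n})^2\big)^{1/2}$, $m\in\mathbb{N}_0$, are finite, with the topology defined by these norms, where $\|\cdot\|_m^{\otimes n}$ is the Hilbertian cross norm. A permutation $\pi$ of $n$ symbols acts on $\bigotimes^n\mathbb{F}_{(\mathbb{C})}$ by $U_\pi(x_1\otimes\cdots\otimes x_n)=(-1)^{\sum_i s_i\sigma_i(\pi)}x_{\pi(1)}\otimes\cdots\otimes x_{\pi(n)}$ when each $x_j$ lies in a single flavor sector, where $\sigma_i(\pi)\in\{0,1\}$ is the parity of the permutation among the factors lying in the $i$-th sector. Let $P^{\mathrm{sym}}_n=\frac1{n!}\sum_\pi U_\pi$. The field algebra is the closed subspace $\mathcal{H}:=A(\mathbb{F}_{(\mathbb{C})})\subset\mathcal{T}_h(\mathbb{F}_{(\mathbb{C})})$ of all $G$ with $P^{\mathrm{sym}}_nG^{(n)}=G^{(n)}$ for all $n$; it is again a countably Hilbert nuclear Fréchet space. $H_m$ is the Hilbert space completion of $\mathcal{H}$ in $\|\cdot\|_m$, with scalar product $\langle\cdot,\cdot\rangle_m$. $\mathbf{1}:=(1,0,0,\dots)$, and $b\,G:=G^{(0)}$ is the (continuous) scalar component map, so that $b\,G=\langle\mathbf{1},G\rangle_m$. **Regularized MDS operator.** $\hbar$ is a fixed real number. $E:F\times\mathbb{F}_T\to\mathbb{R}$,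 $(\psi,\delta\psi_T)\mapsto(E(\psi)|\delta\psi_T)$ is an Euler--Lagrange functional of a classical field theory: it is jointly sequentially continuous and linear in the second variable. It is assumed that there is an element $\mathbf{E}_{\psi_0}\in\mathcal{H}^*\otimes\mathbb{F}_T^*$ (${}^*$ = strong dual) with $(E(\psi)|\delta\psi_T)=\big(\mathbf{E}_{\psi_0}\,\big|\,(1,\psi-\psi_0,\bigotimes^2(\psi-\psi_0),\dots)\otimes\delta\psi_T\big)$ for all $\psi\in F$, $\delta\psi_T\in\mathbb{F}_T$ (this includes the multipolynomial functionals). Contracting the last entry with $\delta\psi_T$ gives $(\mathbf{E}_{\psi_0}|\delta\psi_T)\in\mathcal{H}^*$. For $p=(p^{(0)},p^{(1)},\dots)\in\mathcal{H}^*$, the left insertion operator $\iota_p$ is the continuous linear operator on $\mathcal{H}$ with $(\iota_pG)^{(n)}=\sum_k\big(p^{(k)}\text{ contracted with the first }k\text{ tensor entries of }G^{(n+k)}\big)$. For $u\in\mathbb{F}_{(\mathbb{C})}$, $L_u$ is the left multiplication operator on $\mathcal{H}$, $(L_uG)^{(n+1)}=(n+1)P^{\mathrm{sym}}_{n+1}(u\otimes G^{(n)})$, $(L_uG)^{(0)}=0$. $\kappa$ is a fixed mollifying kernel, i.e. $C_\kappa:\mathbb{F}\to\mathbb{F}$ is an integral operator with smooth properly supported kernel (a properly supported smoothing operator) preserving the flavor sectors. The regularized MDS operator is the continuous linear map $\mathbf{M}_{\psi_0}:\mathcal{H}\otimes\mathbb{F}_T\to\mathcal{H}$, $\mathbf{M}_{\psi_0}(G\otimes\delta\psi_T)=\big(\iota_{(\mathbf{E}_{\psi_0}|\delta\psi_T)}-\mathrm{i}\hbar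 L_{C_\kappa\delta\psi_T}\big)G$. **Hilbert space version.** For all large enough $m,n$, $\mathbf{M}_{\psi_0}$ extends continuously to a Hilbert--Schmidt operator $H_m\otimes_{\mathrm{HS}}F_n\to H_0$, denoted by the same symbol ($\otimes_{\mathrm{HS}}$ = Hilbert--Schmidt, i.e. Hilbert space, tensor product); such $m,n$ are fixed. For an orthonormal basis $(e_i)_{i\in I}$ of $F_n$, the form $B(G_1,G_2)=\sum_{i\in I}\langle\mathbf{M}_{\psi_0}(G_1\otimes e_i),\mathbf{M}_{\psi_0}(G_2\otimes e_i)\rangle_{H_0}$ is a continuous positive semidefinite sesquilinear form on $H_m$ which is independent of the basis, and $\hat{\mathbf{M}}^2_{\psi_0}:H_m\to H_m$ is the unique continuous linear operator with $B(G_1,G_2)=\langle G_1,\hat{\mathbf{M}}^2_{\psi_0}G_2\rangle_m$ for all $G_1,G_2\in H_m$; it is positive and trace class. *)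

theory Defs
  imports "HOL-Analysis.Analysis" "HOL-Library.Function_Algebras"
begin

section \<open>Function spaces and complex Hilbert spaces\<close>

instantiation "fun" :: (type, real_vector) real_vector
begin

definition scaleR_fun :: "real \<Rightarrow> ('a \<Rightarrow> 'b) \<Rightarrow> 'a \<Rightarrow> 'b"
  where "scaleR_fun r f = (\<lambda>x. r *\<^sub>R f x)"

instance
  by standard (simp_all add: scaleR_fun_def fun_eq_iff scaleR_add_right scaleR_add_left)

end

text \<open>The scalar product is antilinear in the first and linear in the second argument.\<close>

class complex_hilbert = banach +
  fixes scaleC :: "complex \<Rightarrow> 'a \<Rightarrow> 'a"
    and cinner :: "'a \<Rightarrow> 'a \<Rightarrow> complex"
  assumes scaleC_add_right: "scaleC c (x + y) = scaleC c x + scaleC c y"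
    and scaleC_add_left: "scaleC (c + d) x = scaleC c x + scaleC d x"
    and scaleC_scaleC: "scaleC c (scaleC d x) = scaleC (c * d) x"
    and scaleC_of_real: "scaleC (complex_of_real r) x = r *\<^sub>R x"
    and cinner_commute: "cinner x y = cnj (cinner y x)"
    and cinner_add_right: "cinner x (y + z) = cinner x y + cinner x z"
    and cinner_scaleC_right: "cinner x (scaleC c y) = c * cinner x y"
    and cinner_self: "cinner x x = complex_of_real ((norm x)\<^sup>2)"

instantiation complex :: complex_hilbert
begin

definition scaleC_complex :: "complex \<Rightarrow> complex \<Rightarrow> complex"
  where "scaleC_complex z w = z * w"

definition cinner_complex :: "complex \<Rightarrow> complex \<Rightarrow> complex"
  where "cinner_complex z w = cnj z * w"

instance
proof
  fix x :: complex
  show "cinner x x = complex_of_real ((norm x)\<^sup>2)"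
    unfolding cinner_complex_def complex_norm_square by (rule mult.commute)
qed (simp_all add: scaleC_complex_def cinner_complex_def algebra_simps scaleR_conv_of_real)

end

definition bounded_clinear :: "('a::complex_hilbert \<Rightarrow> 'b::complex_hilbert) \<Rightarrow> bool"
  where "bounded_clinear f \<longleftrightarrow>
    bounded_linear f \<and> (\<forall>z x. f (scaleC z x) = scaleC z (f x))"

definition orthonormal :: "('a \<Rightarrow> 'a \<Rightarrow> 'k::zero_neq_one) \<Rightarrow> 'a set \<Rightarrow> bool"
  where "orthonormal ip E \<longleftrightarrow> (\<forall>x\<in>E. \<forall>y\<in>E. ip x y = (if x = y then 1 else 0))"

definition orthonormal_basis :: "'a::real_inner set \<Rightarrow> bool"
  where "orthonormal_basis E \<longleftrightarrow> orthonormal (\<lambda>x y. x \<bullet> y) E \<and> closure (span E) = UNIV"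

definition hilbert_schmidt :: "('a::complex_hilbert \<Rightarrow> 'b::complex_hilbert) \<Rightarrow> bool"
  where "hilbert_schmidt f \<longleftrightarrow> bounded_clinear f \<and>
    (\<exists>C. \<forall>E. finite E \<and> orthonormal cinner E \<longrightarrow> (\<Sum>e\<in>E. (norm (f e))\<^sup>2) \<le> C)"

text \<open>
  The Hilbert space tensor product over the reals of a complex and a real Hilbert space, with the
  complex structure of the first factor; it is determined up to unitary equivalence.
\<close>

definition hilbert_tensor ::
    "('a::complex_hilbert \<Rightarrow> 'b::{real_inner, complete_space} \<Rightarrow> 't::complex_hilbert) \<Rightarrow> bool"
  where "hilbert_tensor tens \<longleftrightarrow>
    (\<forall>x x' y. tens (x + x') y = tens x y + tens x' y) \<and>
    (\<forall>x y y'. tens x (y + y') = tens x y + tens x y') \<and>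
    (\<forall>z x y. tens (scaleC z x) y = scaleC z (tens x y)) \<and>
    (\<forall>r x y. tens x (r *\<^sub>R y) = r *\<^sub>R tens x y) \<and>
    (\<forall>x x' y y'. cinner (tens x y) (tens x' y') = cinner x x' * complex_of_real (y \<bullet> y')) \<and>
    closure (span (range (\<lambda>(x, y). tens x y))) = UNIV"

definition orthogonal_projection :: "('a::complex_hilbert \<Rightarrow> 'a) \<Rightarrow> 'a set \<Rightarrow> bool"
  where "orthogonal_projection P K \<longleftrightarrow> (\<forall>x. P x \<in> K \<and> (\<forall>k\<in>K. cinner k (x - P x) = 0))"

text \<open>
  Completion of a real normed space, given by a carrier set and a norm on it: a complete space
  together with an isometric linear embedding of the carrier as a dense subspace.
\<close>

definition real_completion ::
    "'x::real_vector set \<Rightarrow> ('x \<Rightarrow> real) \<Rightarrow> ('x \<Rightarrow> 'h::{real_inner, complete_space}) \<Rightarrow> bool"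
  where "real_completion V nrm \<eta> \<longleftrightarrow>
    (\<forall>x\<in>V. \<forall>y\<in>V. \<eta> (x + y) = \<eta> x + \<eta> y) \<and>
    (\<forall>r. \<forall>x\<in>V. \<eta> (r *\<^sub>R x) = r *\<^sub>R \<eta> x) \<and>
    (\<forall>x\<in>V. norm (\<eta> x) = nrm x) \<and> closure (\<eta> ` V) = UNIV"

section \<open>Countably Hilbert nuclear spaces\<close>

definition ip_norm :: "('a \<Rightarrow> 'a \<Rightarrow> 'k::real_normed_field) \<Rightarrow> 'a \<Rightarrow> real"
  where "ip_norm ip x = sqrt (norm (ip x x))"

definition real_scalar_product :: "'a::real_vector set \<Rightarrow> ('a \<Rightarrow> 'a \<Rightarrow> real) \<Rightarrow> bool"
  where "real_scalar_product V ip \<longleftrightarrow>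
    (\<forall>x\<in>V. \<forall>y\<in>V. ip x y = ip y x) \<and>
    (\<forall>x\<in>V. \<forall>y\<in>V. \<forall>z\<in>V. ip x (y + z) = ip x y + ip x z) \<and>
    (\<forall>x\<in>V. \<forall>y\<in>V. \<forall>r. ip x (r *\<^sub>R y) = r * ip x y) \<and>
    (\<forall>x\<in>V. x \<noteq> 0 \<longrightarrow> 0 < ip x x)"

definition complex_scalar_product ::
    "'a::ab_group_add set \<Rightarrow> (complex \<Rightarrow> 'a \<Rightarrow> 'a) \<Rightarrow> ('a \<Rightarrow> 'a \<Rightarrow> complex) \<Rightarrow> bool"
  where "complex_scalar_product V sc ip \<longleftrightarrow>
    (\<forall>x\<in>V. \<forall>y\<in>V. ip x y = cnj (ip y x)) \<and>
    (\<forall>x\<in>V. \<forall>y\<in>V. \<forall>z\<in>V. ip x (y + z) = ip x y + ip x z) \<and>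
    (\<forall>x\<in>V. \<forall>y\<in>V. \<forall>z. ip x (sc z y) = z * ip x y) \<and>
    (\<forall>x\<in>V. x \<noteq> 0 \<longrightarrow> 0 < Re (ip x x))"

text \<open>
  The metrizable vector topology on \<open>V\<close> is given by the predicate \<open>null\<close> of its null sequences.
  The four clauses say: the norms increase; they define this topology; the canonical maps between the completions are injective (the completions are nested); and the
  inclusions of distant completions are Hilbert--Schmidt.  Compositions of two of the latter
  are then nuclear.
\<close>

definition countably_hilbert_nuclear ::
    "'a::ab_group_add set \<Rightarrow> ((nat \<Rightarrow> 'a) \<Rightarrow> bool) \<Rightarrow>
     (nat \<Rightarrow> 'a \<Rightarrow> 'a \<Rightarrow> 'k::real_normed_field) \<Rightarrow> bool"
  where "countably_hilbert_nuclear V null ip \<longleftrightarrow>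
    (\<forall>m. \<forall>x\<in>V. ip_norm (ip m) x \<le> ip_norm (ip (Suc m)) x) \<and>
    (\<forall>X. range X \<subseteq> V \<longrightarrow> (null X \<longleftrightarrow> (\<forall>m. (\<lambda>k. ip_norm (ip m) (X k)) \<longlonglongrightarrow> 0))) \<and>
    (\<forall>m X. range X \<subseteq> V \<and>
       (\<forall>\<epsilon>>0. \<exists>N. \<forall>k\<ge>N. \<forall>l\<ge>N. ip_norm (ip (Suc m)) (X k - X l) < \<epsilon>) \<and>
       (\<lambda>k. ip_norm (ip m) (X k)) \<longlonglongrightarrow> 0 \<longrightarrow>
       (\<lambda>k. ip_norm (ip (Suc m)) (X k)) \<longlonglongrightarrow> 0) \<and>
    (\<forall>m. \<exists>m'\<ge>m. \<exists>C. \<forall>E. finite E \<and> E \<subseteq> V \<and> orthonormal (ip m') E \<longrightarrow>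
       (\<Sum>e\<in>E. (ip_norm (ip m) e)\<^sup>2) \<le> C)"

section \<open>Analytic tensor algebra\<close>

text \<open>A complex vector space with a sequence of scalar products defining its topology.\<close>

record 'x hilbert_scale =
  pts :: "'x set"
  cmul :: "complex \<Rightarrow> 'x \<Rightarrow> 'x"
  hip :: "nat \<Rightarrow> 'x \<Rightarrow> 'x \<Rightarrow> complex"

definition cdual :: "('x::ab_group_add) hilbert_scale \<Rightarrow> ('x \<Rightarrow> complex) set"
  where "cdual X = {\<phi>.
    (\<forall>x\<in>pts X. \<forall>y\<in>pts X. \<phi> (x + y) = \<phi> x + \<phi> y) \<and>
    (\<forall>z. \<forall>x\<in>pts X. \<phi> (cmul X z x) = z * \<phi> x) \<and>
    (\<exists>m C. \<forall>x\<in>pts X. cmod (\<phi> x) \<le> C * ip_norm (hip X m) x)}"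

text \<open>
  Tensors of degree \<open>n\<close> are realized as multilinear functions on lists of \<open>n\<close> continuous linear
  functionals; they vanish on all other lists.
\<close>

type_synonym 'x tensor = "('x \<Rightarrow> complex) list \<Rightarrow> complex"

definition pure_tensor :: "('x::ab_group_add) hilbert_scale \<Rightarrow> 'x list \<Rightarrow> 'x tensor"
  where "pure_tensor X xs = (\<lambda>\<phi>s.
    if length \<phi>s = length xs \<and> set \<phi>s \<subseteq> cdual X then \<Prod>j<length xs. (\<phi>s ! j) (xs ! j) else 0)"

definition alg_tensor_power :: "('x::ab_group_add) hilbert_scale \<Rightarrow> nat \<Rightarrow> 'x tensor set"
  where "alg_tensor_power X n =
    {(\<lambda>\<phi>s. \<Sum>k<N. c k * pure_tensor X (xs k) \<phi>s) | (N::nat) (c::nat \<Rightarrow> complex) xs.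
      \<forall>k<N. length (xs k) = n \<and> set (xs k) \<subseteq> pts X}"

text \<open>
  The Hilbertian cross norm belonging to the \<open>m\<close>-th norm, computed by Parseval's identity: the
  value of a tensor \<open>t\<close> on the functionals \<open>\<langle>e\<^sub>1, _\<rangle>, \<dots>, \<langle>e\<^sub>n, _\<rangle>\<close> is its scalar product with
  \<open>e\<^sub>1 \<otimes> \<dots> \<otimes> e\<^sub>n\<close>.
\<close>

definition cross_norm :: "('x::ab_group_add) hilbert_scale \<Rightarrow> nat \<Rightarrow> nat \<Rightarrow> 'x tensor \<Rightarrow> real"
  where "cross_norm X m n t = sqrt
    (SUP E \<in> {E. finite E \<and> E \<subseteq> pts X \<and> orthonormal (hip X m) E}.
      \<Sum>es \<in> {es. set es \<subseteq> E \<and> length es = n}. (cmod (t (map (hip X m) es)))\<^sup>2)"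

text \<open>The completion of the algebraic tensor power with respect to all cross norms.\<close>

definition tensor_power :: "('x::ab_group_add) hilbert_scale \<Rightarrow> nat \<Rightarrow> 'x tensor set"
  where "tensor_power X n = {t. \<exists>a. range a \<subseteq> alg_tensor_power X n \<and>
    (\<forall>m. \<forall>\<epsilon>>0. \<exists>N. \<forall>k\<ge>N. \<forall>l\<ge>N. cross_norm X m n (a k - a l) < \<epsilon>) \<and>
    (\<forall>\<phi>s. (\<lambda>k. a k \<phi>s) \<longlonglongrightarrow> t \<phi>s)}"

definition ta_norm :: "('x::ab_group_add) hilbert_scale \<Rightarrow> nat \<Rightarrow> (nat \<Rightarrow> 'x tensor) \<Rightarrow> real"
  where "ta_norm X m G = sqrt (\<Sum>n. 2 ^ (m * n) * (cross_norm X m n (G n))\<^sup>2)"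

definition tensor_algebra :: "('x::ab_group_add) hilbert_scale \<Rightarrow> (nat \<Rightarrow> 'x tensor) set"
  where "tensor_algebra X = {G. (\<forall>n. G n \<in> tensor_power X n) \<and>
    (\<forall>m. summable (\<lambda>n. 2 ^ (m * n) * (cross_norm X m n (G n))\<^sup>2))}"

definition in_degree :: "nat \<Rightarrow> 'x tensor \<Rightarrow> nat \<Rightarrow> 'x tensor"
  where "in_degree k t = (\<lambda>n. if n = k then t else 0)"

definition unit_tensor :: "nat \<Rightarrow> 'x tensor"
  where "unit_tensor = (\<lambda>n \<phi>s. if n = 0 \<and> \<phi>s = [] then 1 else 0)"

definition scalar_component :: "(nat \<Rightarrow> 'x tensor) \<Rightarrow> complex"
  where "scalar_component G = G 0 []"

definition cscale :: "complex \<Rightarrow> (nat \<Rightarrow> 'x tensor) \<Rightarrow> nat \<Rightarrow> 'x tensor"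
  where "cscale z G = (\<lambda>n \<phi>s. z * G n \<phi>s)"

definition left_tensor :: "('x::ab_group_add) hilbert_scale \<Rightarrow> 'x \<Rightarrow> 'x tensor \<Rightarrow> 'x tensor"
  where "left_tensor X u t = (\<lambda>\<phi>s. case \<phi>s of [] \<Rightarrow> 0
    | \<phi> # \<phi>s' \<Rightarrow> if \<phi> \<in> cdual X then \<phi> u * t \<phi>s' else 0)"

text \<open>
  Left insertion of a functional \<open>p\<close> on sequences of tensors; its component of degree \<open>k\<close> is the
  restriction of \<open>p\<close> to tensors of degree \<open>k\<close>.
\<close>

definition left_insertion ::
    "((nat \<Rightarrow> 'x tensor) \<Rightarrow> complex) \<Rightarrow> (nat \<Rightarrow> 'x tensor) \<Rightarrow> nat \<Rightarrow> 'x tensor"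
  where "left_insertion p G = (\<lambda>n \<phi>s. if length \<phi>s = n
    then \<Sum>k. p (in_degree k (\<lambda>\<chi>s. G (n + k) (\<chi>s @ \<phi>s))) else 0)"

definition tensor_completion ::
    "(nat \<Rightarrow> 'x tensor) set \<Rightarrow> ((nat \<Rightarrow> 'x tensor) \<Rightarrow> real) \<Rightarrow>
     ((nat \<Rightarrow> 'x tensor) \<Rightarrow> 'h::complex_hilbert) \<Rightarrow> bool"
  where "tensor_completion V nrm \<eta> \<longleftrightarrow>
    (\<forall>G\<in>V. \<forall>G'\<in>V. \<eta> (G + G') = \<eta> G + \<eta> G') \<and>
    (\<forall>z. \<forall>G\<in>V. \<eta> (cscale z G) = scaleC z (\<eta> G)) \<and>
    (\<forall>G\<in>V. norm (\<eta> G) = nrm G) \<and> closure (\<eta> ` V) = UNIV"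

section \<open>Smooth functions up to the boundary\<close>

text \<open>
  These notions are used on relatively open subsets of half spaces and on products of such sets,
  where derivatives within the set are unique.
\<close>

primrec Ck_on :: "nat \<Rightarrow> 'a::real_normed_vector set \<Rightarrow> ('a \<Rightarrow> 'b::real_normed_vector) \<Rightarrow> bool"
  where
    "Ck_on 0 S f \<longleftrightarrow> continuous_on S f"
  | "Ck_on (Suc k) S f \<longleftrightarrow>
      (\<exists>f'. (\<forall>x\<in>S. (f has_derivative f' x) (at x within S)) \<and> (\<forall>v. Ck_on k S (\<lambda>x. f' x v)))"

definition smooth_on :: "'a::real_normed_vector set \<Rightarrow> ('a \<Rightarrow> 'b::real_normed_vector) \<Rightarrow> bool"
  where "smooth_on S f \<longleftrightarrow> (\<forall>k. Ck_on k S f)"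

primrec iter_deriv ::
    "'a::real_normed_vector set \<Rightarrow> 'a list \<Rightarrow> ('a \<Rightarrow> 'b::real_normed_vector) \<Rightarrow> 'a \<Rightarrow> 'b"
  where
    "iter_deriv S [] f = f"
  | "iter_deriv S (v # vs) f = (\<lambda>x. frechet_derivative (iter_deriv S vs f) (at x within S) v)"

section \<open>Manifolds, affine bundles and their sections\<close>

text \<open>
  A compact manifold is given by a finite atlas indexed by the type \<open>'i\<close>, over whose chart domains
  the affine bundle is trivial.  The transition from the \<open>j\<close>-th to the \<open>i\<close>-th trivialization at
  \<open>p\<close> is the affine map \<open>w \<mapsto> tlin i j p w + toff i j p\<close>; the maps \<open>tlin i j p\<close> alone define
  the subordinate vector bundle.
\<close>

record ('i, 'p, 'd::finite, 'v) affine_bundle =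
  cdom :: "'i \<Rightarrow> 'p set"
  chart :: "'i \<Rightarrow> 'p \<Rightarrow> real ^ 'd"
  tlin :: "'i \<Rightarrow> 'i \<Rightarrow> 'p \<Rightarrow> 'v \<Rightarrow> 'v"
  toff :: "'i \<Rightarrow> 'i \<Rightarrow> 'p \<Rightarrow> 'v"

definition cimg :: "('i, 'p, 'd::finite, 'v, 'z) affine_bundle_scheme \<Rightarrow> 'i \<Rightarrow> (real ^ 'd) set"
  where "cimg A i = chart A i ` cdom A i"

definition cinv :: "('i, 'p, 'd::finite, 'v, 'z) affine_bundle_scheme \<Rightarrow> 'i \<Rightarrow> real ^ 'd \<Rightarrow> 'p"
  where "cinv A i = inv_into (cdom A i) (chart A i)"

definition coverlap ::
    "('i, 'p, 'd::finite, 'v, 'z) affine_bundle_scheme \<Rightarrow> 'i \<Rightarrow> 'i \<Rightarrow> (real ^ 'd) set"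
  where "coverlap A i j = chart A i ` (cdom A i \<inter> cdom A j)"

text \<open>For \<open>a = 0\<close> the half space below is the whole space.\<close>

definition oriented_manifold ::
    "('i::finite, 'p::t2_space, 'd::finite, 'v, 'z) affine_bundle_scheme \<Rightarrow> bool"
  where "oriented_manifold A \<longleftrightarrow>
    compact (UNIV :: 'p set) \<and> (\<Union>i. cdom A i) = UNIV \<and> (\<forall>i. open (cdom A i)) \<and>
    (\<forall>i. homeomorphism (cdom A i) (cimg A i) (chart A i) (cinv A i)) \<and>
    (\<forall>i. \<exists>a. openin (top_of_set {x. 0 \<le> a \<bullet> x}) (cimg A i)) \<and>
    (\<forall>i j. smooth_on (coverlap A i j) (chart A j \<circ> cinv A i)) \<and>
    (\<forall>i j. \<forall>x\<in>coverlap A i j.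
       0 < det (matrix (frechet_derivative (chart A j \<circ> cinv A i) (at x within coverlap A i j))))"

definition manifold_boundary :: "('i, 'p, 'd::finite, 'v, 'z) affine_bundle_scheme \<Rightarrow> 'p set"
  where "manifold_boundary A = {p. \<exists>i. p \<in> cdom A i \<and> chart A i p \<notin> interior (cimg A i)}"

text \<open>
  Every point has a neighbourhood in a chart, all of whose points are vertices of congruent finite
  cones contained in the chart image.
\<close>

definition cone_property ::
    "('i, 'p::topological_space, 'd::finite, 'v, 'z) affine_bundle_scheme \<Rightarrow> bool"
  where "cone_property A \<longleftrightarrow>
    (\<forall>p. \<exists>i U r t. open U \<and> p \<in> U \<and> U \<subseteq> cdom A i \<and> 0 < r \<and> t < 1 \<and>
      (\<forall>q\<in>U. \<exists>a. norm a = 1 \<and>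
        {chart A i q + v | v. norm v < r \<and> t * norm v \<le> a \<bullet> v} \<subseteq> cimg A i))"

definition affine_cocycle ::
    "('i, 'p, 'd::finite, 'v::euclidean_space, 'z) affine_bundle_scheme \<Rightarrow> bool"
  where "affine_cocycle A \<longleftrightarrow>
    (\<forall>i j. \<forall>p \<in> cdom A i \<inter> cdom A j. linear (tlin A i j p)) \<and>
    (\<forall>i j w. smooth_on (coverlap A i j) (\<lambda>x. tlin A i j (cinv A i x) w)) \<and>
    (\<forall>i j. smooth_on (coverlap A i j) (\<lambda>x. toff A i j (cinv A i x))) \<and>
    (\<forall>i. \<forall>p \<in> cdom A i. (\<forall>w. tlin A i i p w = w) \<and> toff A i i p = 0) \<and>
    (\<forall>i j k. \<forall>p \<in> cdom A i \<inter> cdom A j \<inter> cdom A k.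
       (\<forall>w. tlin A i k p w = tlin A i j p (tlin A j k p w)) \<and>
       toff A i k p = tlin A i j p (toff A j k p) + toff A i j p)"

text \<open>A section is the family of its local representatives, which are 0 outside their domains.\<close>

type_synonym ('i, 'p, 'v) sec = "'i \<Rightarrow> 'p \<Rightarrow> 'v"

definition local_rep ::
    "('i, 'p, 'd::finite, 'v, 'z) affine_bundle_scheme \<Rightarrow> ('i, 'p, 'v) sec \<Rightarrow> 'i \<Rightarrow> real ^ 'd \<Rightarrow> 'v"
  where "local_rep A \<psi> i = \<psi> i \<circ> cinv A i"

definition affine_sections ::
    "('i, 'p, 'd::finite, 'v::euclidean_space, 'z) affine_bundle_scheme \<Rightarrow> ('i, 'p, 'v) sec set"
  where "affine_sections A = {\<psi>.
    (\<forall>i p. p \<notin> cdom A i \<longrightarrow> \<psi> i p = 0) \<and> (\<forall>i. smooth_on (cimg A i) (local_rep A \<psi> i)) \<and>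
    (\<forall>i j. \<forall>p \<in> cdom A i \<inter> cdom A j. \<psi> i p = tlin A i j p (\<psi> j p) + toff A i j p)}"

definition vector_sections ::
    "('i, 'p, 'd::finite, 'v::euclidean_space, 'z) affine_bundle_scheme \<Rightarrow> ('i, 'p, 'v) sec set"
  where "vector_sections A = {\<psi>.
    (\<forall>i p. p \<notin> cdom A i \<longrightarrow> \<psi> i p = 0) \<and> (\<forall>i. smooth_on (cimg A i) (local_rep A \<psi> i)) \<and>
    (\<forall>i j. \<forall>p \<in> cdom A i \<inter> cdom A j. \<psi> i p = tlin A i j p (\<psi> j p))}"

definition boundary_flat_sections ::
    "('i, 'p, 'd::finite, 'v::euclidean_space, 'z) affine_bundle_scheme \<Rightarrow> ('i, 'p, 'v) sec set"
  where "boundary_flat_sections A = {\<psi> \<in> vector_sections A.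
    \<forall>i vs. \<forall>p \<in> cdom A i \<inter> manifold_boundary A.
      iter_deriv (cimg A i) vs (local_rep A \<psi> i) (chart A i p) = 0}"

text \<open>
  Convergence to 0 in the \<open>C\<^sup>\<infinity>\<close> topology.  This topology is metrizable, so that topological
  notions can be expressed by sequences.
\<close>

definition smooth_null ::
    "('i, 'p, 'd::finite, 'v::euclidean_space, 'z) affine_bundle_scheme \<Rightarrow>
     (nat \<Rightarrow> ('i, 'p, 'v) sec) \<Rightarrow> bool"
  where "smooth_null A \<psi> \<longleftrightarrow> (\<forall>i vs K. compact K \<and> K \<subseteq> cimg A i \<longrightarrow>
    uniform_limit K (\<lambda>k. iter_deriv (cimg A i) vs (local_rep A (\<psi> k) i)) (\<lambda>_. 0) sequentially)"

definition closed_subspace ::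
    "('i, 'p, 'd::finite, 'v::euclidean_space, 'z) affine_bundle_scheme \<Rightarrow>
     ('i, 'p, 'v) sec set \<Rightarrow> bool"
  where "closed_subspace A W \<longleftrightarrow> subspace W \<and> W \<subseteq> vector_sections A \<and>
    (\<forall>\<psi> \<psi>'. range \<psi> \<subseteq> W \<and> \<psi>' \<in> vector_sections A \<and> smooth_null A (\<lambda>k. \<psi> k - \<psi>') \<longrightarrow> \<psi>' \<in> W)"

section \<open>Classical field theories\<close>

text \<open>
  \<open>ELf \<psi> \<delta>\<close> is \<open>(E(\<psi>)|\<delta>)\<close>; \<open>kern i j\<close> is the local expression of the mollifying kernel
  \<open>\<kappa>\<close>, see below.  The flavor sectors are \<open>sector k\<close> for \<open>k < nsec\<close>.
\<close>

record ('i, 'p, 'd::finite, 'v) field_theory = "('i, 'p, 'd, 'v) affine_bundle" +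
  test :: "('i, 'p, 'v) sec set"
  real_fields :: "('i, 'p, 'v) sec set"
  complex_fields :: "('i, 'p, 'v) sec set"
  imag :: "('i, 'p, 'v) sec \<Rightarrow> ('i, 'p, 'v) sec"
  nsec :: nat
  sector :: "nat \<Rightarrow> ('i, 'p, 'v) sec set"
  fermi :: "nat \<Rightarrow> nat"
  fip :: "nat \<Rightarrow> ('i, 'p, 'v) sec \<times> ('i, 'p, 'v) sec \<times> ('i, 'p, 'v) sec \<Rightarrow>
    ('i, 'p, 'v) sec \<times> ('i, 'p, 'v) sec \<times> ('i, 'p, 'v) sec \<Rightarrow> complex"
  tip :: "nat \<Rightarrow> ('i, 'p, 'v) sec \<Rightarrow> ('i, 'p, 'v) sec \<Rightarrow> real"
  ELf :: "('i, 'p, 'v) sec \<Rightarrow> ('i, 'p, 'v) sec \<Rightarrow> real"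
  kern :: "'i \<Rightarrow> 'i \<Rightarrow> real ^ 'd \<Rightarrow> real ^ 'd \<Rightarrow> 'v \<Rightarrow> 'v"
  hbar :: real

definition part :: "'a::ab_group_add set \<Rightarrow> 'a set \<Rightarrow> 'a \<Rightarrow> 'a"
  where "part U W x = (THE u. u \<in> U \<and> x - u \<in> W)"

definition real_part where
  "real_part T = part (real_fields T) (complex_fields T)"

definition complex_part where
  "complex_part T = part (complex_fields T) (real_fields T)"

definition sector_part where
  "sector_part T k = part (sector T k) (span (\<Union>l \<in> {..<nsec T} - {k}. sector T l))"

text \<open>
  Elements of the partial complexification are triples \<open>(a, b, c)\<close> standing for
  \<open>(a \<otimes> 1 + b \<otimes> \<i>) + c\<close> with \<open>a, b\<close> real and \<open>c\<close> complex fields.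
\<close>

type_synonym ('i, 'p, 'v) csec = "('i, 'p, 'v) sec \<times> ('i, 'p, 'v) sec \<times> ('i, 'p, 'v) sec"

definition cfields ::
    "('i, 'p, 'd::finite, 'v::euclidean_space) field_theory \<Rightarrow> ('i, 'p, 'v) csec hilbert_scale"
  where "cfields T = \<lparr>
    pts = real_fields T \<times> real_fields T \<times> complex_fields T,
    cmul = (\<lambda>z (a, b, c). (Re z *\<^sub>R a - Im z *\<^sub>R b, Re z *\<^sub>R b + Im z *\<^sub>R a,
      Re z *\<^sub>R c + Im z *\<^sub>R imag T c)),
    hip = fip T\<rparr>"

definition cfield_of ::
    "('i, 'p, 'd::finite, 'v::euclidean_space) field_theory \<Rightarrow> ('i, 'p, 'v) sec \<Rightarrow> ('i, 'p, 'v) csec"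
  where "cfield_of T \<psi> = (real_part T \<psi>, 0, complex_part T \<psi>)"

definition csector_part ::
    "('i, 'p, 'd::finite, 'v::euclidean_space) field_theory \<Rightarrow> nat \<Rightarrow>
     ('i, 'p, 'v) csec \<Rightarrow> ('i, 'p, 'v) csec"
  where "csector_part T k = (\<lambda>(a, b, c). (sector_part T k a, sector_part T k b, sector_part T k c))"

definition cfield_null ::
    "('i, 'p, 'd::finite, 'v::euclidean_space) field_theory \<Rightarrow> (nat \<Rightarrow> ('i, 'p, 'v) csec) \<Rightarrow> bool"
  where "cfield_null T x \<longleftrightarrow> smooth_null T (\<lambda>k. fst (x k)) \<and>
    smooth_null T (\<lambda>k. fst (snd (x k))) \<and> smooth_null T (\<lambda>k. snd (snd (x k)))"

text \<open>
  The integral operator with kernel \<open>\<kappa>\<close>.  Cutting off with a partition of unity subordinate to the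
  atlas in the integration variable, every smooth kernel can be written with local expressions
  \<open>kern i j x y\<close> which are compactly supported in \<open>y\<close>.  On a compact manifold every kernel is
  properly supported.
\<close>

definition mollify ::
    "('i::finite, 'p, 'd::finite, 'v::euclidean_space) field_theory \<Rightarrow>
     ('i, 'p, 'v) sec \<Rightarrow> ('i, 'p, 'v) sec"
  where "mollify T \<psi> = (\<lambda>i p. if p \<in> cdom T i
    then \<Sum>j\<in>UNIV. integral (cimg T j) (\<lambda>y. kern T i j (chart T i p) y (local_rep T \<psi> j y))
    else 0)"

definition smooth_kernel ::
    "('i::finite, 'p, 'd::finite, 'v::euclidean_space) field_theory \<Rightarrow> bool"
  where "smooth_kernel T \<longleftrightarrow>
    (\<forall>i j. \<forall>x\<in>cimg T i. \<forall>y\<in>cimg T j. linear (kern T i j x y)) \<and>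
    (\<forall>i j w. smooth_on (cimg T i \<times> cimg T j) (\<lambda>(x, y). kern T i j x y w)) \<and>
    (\<forall>i j. \<exists>K. compact K \<and> K \<subseteq> cimg T j \<and>
       (\<forall>x\<in>cimg T i. \<forall>y\<in>cimg T j - K. \<forall>w. kern T i j x y w = 0)) \<and>
    mollify T ` vector_sections T \<subseteq> vector_sections T"

definition real_complex_splitting ::
    "('i, 'p, 'd::finite, 'v::euclidean_space) field_theory \<Rightarrow> bool"
  where "real_complex_splitting T \<longleftrightarrow>
    closed_subspace T (real_fields T) \<and> closed_subspace T (complex_fields T) \<and>
    (\<forall>\<psi> \<in> vector_sections T. \<exists>!\<rho>. \<rho> \<in> real_fields T \<and> \<psi> - \<rho> \<in> complex_fields T) \<and>
    (\<forall>\<psi> \<in> complex_fields T. imag T \<psi> \<in> complex_fields T \<and> imag T (imag T \<psi>) = - \<psi> \<and>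
      (\<forall>\<psi>' \<in> complex_fields T. imag T (\<psi> + \<psi>') = imag T \<psi> + imag T \<psi>') \<and>
      (\<forall>r. imag T (r *\<^sub>R \<psi>) = r *\<^sub>R imag T \<psi>))"

text \<open>
  The sectors consisting of complex fields are complex subspaces; without this the permutations
  would not act complex linearly.
\<close>

definition flavor_splitting ::
    "('i, 'p, 'd::finite, 'v::euclidean_space) field_theory \<Rightarrow> bool"
  where "flavor_splitting T \<longleftrightarrow>
    (\<forall>k<nsec T. closed_subspace T (sector T k) \<and> fermi T k \<in> {0, 1} \<and>
      (sector T k \<subseteq> real_fields T \<or>
       sector T k \<subseteq> complex_fields T \<and> imag T ` sector T k \<subseteq> sector T k)) \<and>
    (\<forall>\<psi> \<in> vector_sections T. \<exists>!c. c \<in> (\<Pi>\<^sub>E k\<in>{..<nsec T}. sector T k) \<and> \<psi> = (\<Sum>k<nsec T. c k))"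

definition test_space :: "('i, 'p, 'd::finite, 'v::euclidean_space) field_theory \<Rightarrow> bool"
  where "test_space T \<longleftrightarrow>
    (test T = vector_sections T \<or> test T = boundary_flat_sections T) \<and>
    (\<forall>\<delta> \<in> test T. real_part T \<delta> \<in> test T \<and> complex_part T \<delta> \<in> test T \<and>
      (\<forall>k<nsec T. sector_part T k \<delta> \<in> test T))"

definition euler_lagrange_functional ::
    "('i, 'p, 'd::finite, 'v::euclidean_space) field_theory \<Rightarrow> bool"
  where "euler_lagrange_functional T \<longleftrightarrow>
    (\<forall>\<psi> \<in> affine_sections T. \<forall>\<delta> \<in> test T.
      (\<forall>\<delta>' \<in> test T. ELf T \<psi> (\<delta> + \<delta>') = ELf T \<psi> \<delta> + ELf T \<psi> \<delta>') \<and>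
      (\<forall>r. ELf T \<psi> (r *\<^sub>R \<delta>) = r * ELf T \<psi> \<delta>)) \<and>
    (\<forall>\<psi>s \<psi> \<delta>s \<delta>. range \<psi>s \<subseteq> affine_sections T \<and> \<psi> \<in> affine_sections T \<and>
      range \<delta>s \<subseteq> test T \<and> \<delta> \<in> test T \<and>
      smooth_null T (\<lambda>k. \<psi>s k - \<psi>) \<and> smooth_null T (\<lambda>k. \<delta>s k - \<delta>) \<longrightarrow>
      (\<lambda>k. ELf T (\<psi>s k) (\<delta>s k)) \<longlonglongrightarrow> ELf T \<psi> \<delta>)"

definition regularized_field_theory ::
    "('i::finite, 'p::t2_space, 'd::finite, 'v::euclidean_space) field_theory \<Rightarrow> bool"
  where "regularized_field_theory T \<longleftrightarrow>
    oriented_manifold T \<and> (manifold_boundary T \<noteq> {} \<longrightarrow> cone_property T) \<and> affine_cocycle T \<and>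
    real_complex_splitting T \<and> flavor_splitting T \<and> test_space T \<and>
    (\<forall>m. complex_scalar_product (pts (cfields T)) (cmul (cfields T)) (fip T m)) \<and>
    countably_hilbert_nuclear (pts (cfields T)) (cfield_null T) (fip T) \<and>
    (\<forall>n. real_scalar_product (test T) (tip T n)) \<and>
    countably_hilbert_nuclear (test T) (smooth_null T) (tip T) \<and>
    euler_lagrange_functional T \<and>
    smooth_kernel T \<and> (\<forall>k<nsec T. mollify T ` sector T k \<subseteq> sector T k)"

section \<open>Field algebra and the regularized master Dyson--Schwinger operator\<close>

text \<open>
  \<open>perm_parity T n \<pi> as i\<close> counts the inversions of \<open>\<pi>\<close> among the factors in the \<open>i\<close>-th sector,
  when the \<open>j\<close>-th factor is in the sector \<open>as ! j\<close>.
\<close>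

definition perm_parity :: "nat \<Rightarrow> (nat \<Rightarrow> nat) \<Rightarrow> nat list \<Rightarrow> nat \<Rightarrow> nat"
  where "perm_parity n \<pi> as i =
    card {(k, l). k < l \<and> l < n \<and> \<pi> l < \<pi> k \<and> as ! \<pi> k = i \<and> as ! \<pi> l = i} mod 2"

text \<open>
  For \<open>x\<^sub>j\<close> in the sector \<open>as ! j\<close>, the tensor \<open>x\<^bsub>\<pi>(0)\<^esub> \<otimes> \<dots> \<otimes> x\<^bsub>\<pi>(n-1)\<^esub>\<close> takes on
  \<open>(\<phi>\<^sub>0, \<dots>)\<close> the value of \<open>x\<^sub>0 \<otimes> \<dots> \<otimes> x\<^bsub>n-1\<^esub>\<close> on the functionals \<open>\<phi>\<^sub>k\<close> with
  \<open>k = \<pi>\<^sup>-\<^sup>1(j)\<close>.  For general tensors the entries are decomposed into sectors.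
\<close>

definition perm_action ::
    "('i, 'p, 'd::finite, 'v::euclidean_space) field_theory \<Rightarrow> nat \<Rightarrow> (nat \<Rightarrow> nat) \<Rightarrow>
     ('i, 'p, 'v) csec tensor \<Rightarrow> ('i, 'p, 'v) csec tensor"
  where "perm_action T n \<pi> t = (\<lambda>\<phi>s. if length \<phi>s = n \<and> set \<phi>s \<subseteq> cdual (cfields T)
    then \<Sum>as \<in> {as. set as \<subseteq> {..<nsec T} \<and> length as = n}.
      (- 1) ^ (\<Sum>i<nsec T. fermi T i * perm_parity n \<pi> as i) *
      t (map (\<lambda>j. \<phi>s ! inv \<pi> j \<circ> csector_part T (as ! j)) [0..<n])
    else 0)"

definition sym_proj ::
    "('i, 'p, 'd::finite, 'v::euclidean_space) field_theory \<Rightarrow> nat \<Rightarrow>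
     ('i, 'p, 'v) csec tensor \<Rightarrow> ('i, 'p, 'v) csec tensor"
  where "sym_proj T n t = (\<lambda>\<phi>s. (\<Sum>\<pi> | \<pi> permutes {..<n}. perm_action T n \<pi> t \<phi>s) / fact n)"

definition field_algebra ::
    "('i, 'p, 'd::finite, 'v::euclidean_space) field_theory \<Rightarrow> (nat \<Rightarrow> ('i, 'p, 'v) csec tensor) set"
  where "field_algebra T = {G \<in> tensor_algebra (cfields T). \<forall>n. sym_proj T n (G n) = G n}"

definition left_mult ::
    "('i, 'p, 'd::finite, 'v::euclidean_space) field_theory \<Rightarrow> ('i, 'p, 'v) csec \<Rightarrow>
     (nat \<Rightarrow> ('i, 'p, 'v) csec tensor) \<Rightarrow> nat \<Rightarrow> ('i, 'p, 'v) csec tensor"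
  where "left_mult T u G = (\<lambda>n. case n of 0 \<Rightarrow> 0
    | Suc n' \<Rightarrow> (\<lambda>\<phi>s. of_nat (Suc n') *
        sym_proj T (Suc n') (left_tensor (cfields T) u (G n')) \<phi>s))"

text \<open>
  The tensor product of the strong duals of two nuclear Frechet spaces is the space of continuous
  bilinear forms.  The functional \<open>EE\<close> is given as such a form on the whole tensor algebra, since
  it has to be evaluated on the tensors \<open>\<Otimes>\<^sup>k (\<psi> - \<psi>\<^sub>0)\<close>, which need not be graded symmetric.
  Only its restriction to the field algebra enters the master Dyson--Schwinger operator, and every
  continuous bilinear form on the field algebra extends to the tensor algebra.  As
  \<open>(1, \<psi> - \<psi>\<^sub>0, \<dots>)\<close> is not in the tensor algebra for large \<open>\<psi> - \<psi>\<^sub>0\<close>, the evaluation is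
  the sum of the contributions of all degrees.
\<close>

definition represents_EL ::
    "('i, 'p, 'd::finite, 'v::euclidean_space) field_theory \<Rightarrow> ('i, 'p, 'v) sec \<Rightarrow>
     ((nat \<Rightarrow> ('i, 'p, 'v) csec tensor) \<Rightarrow> ('i, 'p, 'v) sec \<Rightarrow> complex) \<Rightarrow> bool"
  where "represents_EL T \<psi>\<^sub>0 EE \<longleftrightarrow>
    (\<forall>G \<in> tensor_algebra (cfields T). \<forall>\<delta> \<in> test T.
      (\<forall>G' \<in> tensor_algebra (cfields T). EE (G + G') \<delta> = EE G \<delta> + EE G' \<delta>) \<and>
      (\<forall>z. EE (cscale z G) \<delta> = z * EE G \<delta>) \<and>
      (\<forall>\<delta>' \<in> test T. EE G (\<delta> + \<delta>') = EE G \<delta> + EE G \<delta>') \<and>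
      (\<forall>r. EE G (r *\<^sub>R \<delta>) = complex_of_real r * EE G \<delta>)) \<and>
    (\<exists>m n C. \<forall>G \<in> tensor_algebra (cfields T). \<forall>\<delta> \<in> test T.
      cmod (EE G \<delta>) \<le> C * ta_norm (cfields T) m G * ip_norm (tip T n) \<delta>) \<and>
    (\<forall>\<psi> \<in> affine_sections T. \<forall>\<delta> \<in> test T.
      (\<lambda>k. EE (in_degree k (pure_tensor (cfields T) (replicate k (cfield_of T (\<psi> - \<psi>\<^sub>0))))) \<delta>)
      sums complex_of_real (ELf T \<psi> \<delta>))"

definition mds_operator ::
    "('i::finite, 'p, 'd::finite, 'v::euclidean_space) field_theory \<Rightarrow>
     ((nat \<Rightarrow> ('i, 'p, 'v) csec tensor) \<Rightarrow> ('i, 'p, 'v) sec \<Rightarrow> complex) \<Rightarrow>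
     (nat \<Rightarrow> ('i, 'p, 'v) csec tensor) \<Rightarrow> ('i, 'p, 'v) sec \<Rightarrow> nat \<Rightarrow> ('i, 'p, 'v) csec tensor"
  where "mds_operator T EE G \<delta> =
    left_insertion (\<lambda>G'. EE G' \<delta>) G -
    cscale (\<i> * complex_of_real (hbar T)) (left_mult T (cfield_of T (mollify T \<delta>)) G)"

text \<open>The form \<open>B\<close>, computed with an orthonormal basis \<open>I\<close> of the second tensor factor.\<close>

definition mds_form ::
    "('h \<Rightarrow> 'f \<Rightarrow> 't) \<Rightarrow> ('t \<Rightarrow> 'h0::complex_hilbert) \<Rightarrow> 'f set \<Rightarrow> 'h \<Rightarrow> 'h \<Rightarrow> complex"
  where "mds_form tens M I G G' = (\<Sum>\<^sub>\<infinity>e\<in>I. cinner (M (tens G e)) (M (tens G' e)))"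

end

theory Submission
  imports Defs
begin

text \<open>
  The scalar component is the scalar product with the unit: adding a multiple of the unit to an
  element of the field algebra changes its norm only in degree 0, so polarization and density of
  the field algebra give \<open>b G = \<langle>1, G\<rangle>\<close>.  Since \<open>M\<close> is Hilbert--Schmidt, the sum defining \<open>B(G, G)\<close>
  converges, hence the kernel of the associated operator consists of the solutions of the
  homogeneous equation \<open>M (G \<otimes> f) = 0\<close> for all \<open>f\<close>.  The rest is Hilbert space geometry:
  \<open>b (P 1) = \<langle>1, P 1\<rangle> = \<parallel>P 1\<parallel>\<^sup>2\<close>, and \<open>P 1 = 0\<close> iff \<open>b\<close> vanishes on the kernel.
\<close>

section \<open>Complex Hilbert spaces\<close>

lemma cinner_add_left: "cinner (x + y) z = cinner x z + cinner y (z::'a::complex_hilbert)"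
  by (metis cinner_add_right cinner_commute complex_cnj_add)

lemma cinner_scaleC_left: "cinner (scaleC c x) y = cnj c * cinner x (y::'a::complex_hilbert)"
  by (metis cinner_commute cinner_scaleC_right complex_cnj_mult)

lemma cinner_zero_right [simp]: "cinner x (0::'a::complex_hilbert) = 0"
  using cinner_add_right[of x 0 0] by simp

lemma cinner_zero_left [simp]: "cinner (0::'a::complex_hilbert) x = 0"
  using cinner_add_left[of 0 0 x] by simp

lemma cinner_diff_right: "cinner x (y - z) = cinner x y - cinner x (z::'a::complex_hilbert)"
  using cinner_add_right[of x "y - z" z] by simp

lemma cinner_eq_zero_iff: "cinner x x = 0 \<longleftrightarrow> (x::'a::complex_hilbert) = 0"
  by (simp add: cinner_self)

lemma norm_add_scaleC_sq:
  fixes x u :: "'a::complex_hilbert"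
  shows "(norm (x + scaleC c u))\<^sup>2 = (norm x)\<^sup>2 + 2 * Re (cnj c * cinner u x) + (cmod c)\<^sup>2 * (norm u)\<^sup>2"
proof -
  have "cinner x u = cnj (cinner u x)"
    by (rule cinner_commute)
  then have "cinner (x + scaleC c u) (x + scaleC c u)
      = cinner x x + (cnj c * cinner u x + cnj (cnj c * cinner u x)) + c * cnj c * cinner u u"
    by (simp add: cinner_add_left cinner_add_right cinner_scaleC_left cinner_scaleC_right algebra_simps)
  also have "\<dots> = complex_of_real
      ((norm x)\<^sup>2 + 2 * Re (cnj c * cinner u x) + (cmod c)\<^sup>2 * (norm u)\<^sup>2)"
    unfolding complex_add_cnj cinner_self complex_norm_square[symmetric] by simp
  finally show ?thesis
    unfolding cinner_self of_real_eq_iff .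
qed

text \<open>In the expansion of the squared norm the quadratic terms agree for c and -c and cancel.
  Having the scalar product in terms of norms gives its continuity below, and lets
  \<open>cinner\<close> be computed in a completion, where only norms are prescribed.\<close>

lemma cinner_polarization:
  fixes x u :: "'a::complex_hilbert"
  shows "cinner u x = Complex
    (((norm (x + scaleC 1 u))\<^sup>2 - (norm (x + scaleC (- 1) u))\<^sup>2) / 4)
    (((norm (x + scaleC \<i> u))\<^sup>2 - (norm (x + scaleC (- \<i>) u))\<^sup>2) / 4)"
  unfolding norm_add_scaleC_sq by (simp add: complex_eq_iff)

lemma continuous_on_cinner_right: "continuous_on S (cinner (u::'a::complex_hilbert))"
proof -
  have "continuous_on S (\<lambda>x. complex_of_real
      (((norm (x + scaleC 1 u))\<^sup>2 - (norm (x + scaleC (- 1) u))\<^sup>2) / 4) + \<i> * complex_of_real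
      (((norm (x + scaleC \<i> u))\<^sup>2 - (norm (x + scaleC (- \<i>) u))\<^sup>2) / 4))"
    by (intro continuous_intros) auto
  then show ?thesis
    by (subst (asm) continuous_on_cong[OF refl, of _ _ "cinner u"])
      (simp_all add: cinner_polarization Complex_eq)
qed

lemma eq_on_dense_imp_eq:
  fixes f g :: "'a::topological_space \<Rightarrow> 'b::t2_space"
  assumes "continuous_on UNIV f" "continuous_on UNIV g" "closure S = UNIV" "\<And>x. x \<in> S \<Longrightarrow> f x = g x"
  shows "f x = g x"
proof -
  have "closed {x. f x = g x}"
    using assms(1,2) by (rule closed_Collect_eq)
  with assms(4) have "closure S \<subseteq> {x. f x = g x}"
    by (intro closure_minimal) auto
  with assms(3) show ?thesis by auto
qed

text \<open>\<open>P u\<close> itself lies in K, so it is orthogonal to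
  \<open>u - P u\<close>.\<close>

lemma orthogonal_projection_cinner:
  assumes "orthogonal_projection P K"
  shows "cinner u (P u) = complex_of_real ((norm (P u))\<^sup>2)"
proof -
  have "cinner (P u) (u - P u) = 0"
    using assms unfolding orthogonal_projection_def by blast
  then have "cinner (P u) u = cinner (P u) (P u)"
    by (simp add: cinner_diff_right)
  then show ?thesis
    using cinner_commute[of u "P u"] by (simp add: cinner_self)
qed

lemma orthogonal_projection_eq_zeroD:
  assumes "orthogonal_projection P K" "P u = 0" "k \<in> K"
  shows "cinner u k = 0"
proof -
  have "cinner k (u - P u) = 0"
    using assms unfolding orthogonal_projection_def by blast
  then show ?thesis
    using assms(2) cinner_commute[of u k] by simp
qed

section \<open>Hilbert tensor products and Hilbert--Schmidt operators\<close>

lemma hilbert_tensor_norm: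
  assumes "hilbert_tensor tens"
  shows "norm (tens x y) = norm x * norm y"
proof -
  have "cinner (tens x y) (tens x y) = cinner x x * complex_of_real (y \<bullet> y)"
    using assms by (simp add: hilbert_tensor_def)
  then have "(norm (tens x y))\<^sup>2 = (norm x * norm y)\<^sup>2"
    unfolding cinner_self power2_norm_eq_inner[symmetric]
    by (metis of_real_eq_iff of_real_mult power_mult_distrib)
  then show ?thesis by simp
qed

lemma hilbert_tensor_bounded_linear_right:
  assumes "hilbert_tensor tens"
  shows "bounded_linear (tens x)"
proof (rule bounded_linear_intro)
  show "norm (tens x y) \<le> norm y * norm x" for y
    by (simp add: hilbert_tensor_norm[OF assms])
qed (use assms in \<open>simp_all add: hilbert_tensor_def\<close>)

lemma hilbert_tensor_zero_left:
  assumes "hilbert_tensor tens"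
  shows "tens 0 y = 0"
  using hilbert_tensor_norm[OF assms, of 0 y] by simp

text \<open>Makes the Hilbert--Schmidt bound, stated for orthonormal sets in the tensor product,
  applicable to sums over orthonormal sets in the second factor; injectivity serves to reindex these
  sums.\<close>

lemma orthonormal_tens:
  assumes tens: "hilbert_tensor tens" and E: "orthonormal (\<lambda>x y. x \<bullet> y) E" and x: "norm x = 1"
  shows "orthonormal cinner (tens x ` E)" "inj_on (tens x) E"
proof -
  have ip: "cinner (tens x e) (tens x e') = (if e = e' then 1 else 0)" if "e \<in> E" "e' \<in> E" for e e'
    using tens E x that by (simp add: hilbert_tensor_def orthonormal_def cinner_self)
  show inj: "inj_on (tens x) E"
    by (rule inj_onI) (metis ip one_neq_zero)
  show "orthonormal cinner (tens x ` E)"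
    using ip inj by (auto simp: orthonormal_def inj_on_eq_iff)
qed

text \<open>For a unit vector x the Hilbert--Schmidt constant bounds all finite partial sums;
  homogeneity gives the general case. As \<open>infsum\<close> is 0 on families that are not
  summable, a vanishing form says something about its terms only after this.\<close>

lemma hilbert_schmidt_tens_summable:
  assumes tens: "hilbert_tensor tens" and M: "hilbert_schmidt M"
    and E: "orthonormal (\<lambda>x y. x \<bullet> y) E"
  shows "(\<lambda>e. (norm (M (tens x e)))\<^sup>2) summable_on E"
proof (cases "x = 0")
  case True
  have "linear M"
    using M by (simp add: hilbert_schmidt_def bounded_clinear_def bounded_linear.linear)
  then show ?thesis
    using True by (simp add: hilbert_tensor_zero_left[OF tens] linear_0)
next
  case False
  \<comment> \<open>The normalization uses \<open>scaleC\<close> because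
    \<open>hilbert_tensor\<close> states homogeneity in the first factor for complex
    scalars.\<close>
  define v where "v = scaleC (complex_of_real (1 / norm x)) x"
  have v: "norm v = 1"
    using False by (simp only: v_def scaleC_of_real) simp
  have x_eq: "x = scaleC (complex_of_real (norm x)) v"
    using False by (simp only: v_def scaleC_of_real) simp
  obtain C where C: "\<And>F. finite F \<Longrightarrow> orthonormal cinner F \<Longrightarrow> (\<Sum>e\<in>F. (norm (M e))\<^sup>2) \<le> C"
    using M by (auto simp: hilbert_schmidt_def)
  have "(\<lambda>e. (norm (M (tens v e)))\<^sup>2) summable_on E"
  proof (rule nonneg_bdd_above_summable_on)
    have "(\<Sum>e\<in>F. (norm (M (tens v e)))\<^sup>2) \<le> C" if "F \<subseteq> E" "finite F" for F
    proof -
      have F: "orthonormal (\<lambda>x y. x \<bullet> y) F"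
        using E that unfolding orthonormal_def by blast
      show ?thesis
        using C[OF _ orthonormal_tens(1)[OF tens F v]] orthonormal_tens(2)[OF tens F v] that
        by (simp add: sum.reindex)
    qed
    then show "bdd_above (sum (\<lambda>e. (norm (M (tens v e)))\<^sup>2) ` {F. F \<subseteq> E \<and> finite F})"
      by (intro bdd_aboveI[of _ C]) auto
  qed simp
  moreover have "(norm (M (tens x e)))\<^sup>2 = (norm x)\<^sup>2 * (norm (M (tens v e)))\<^sup>2" for e
  proof -
    have "tens x e = scaleC (complex_of_real (norm x)) (tens v e)"
      using tens by (subst x_eq) (simp add: hilbert_tensor_def)
    then have "M (tens x e) = norm x *\<^sub>R M (tens v e)"
      using M by (simp add: hilbert_schmidt_def bounded_clinear_def scaleC_of_real[symmetric])
    then show ?thesis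
      by (simp add: power_mult_distrib)
  qed
  ultimately show ?thesis
    by (simp add: summable_on_cmult_right)
qed

lemma kernel_mds_form:
  assumes tens: "hilbert_tensor tens" and M: "hilbert_schmidt M" and I: "orthonormal_basis I"
    and Msq: "\<forall>G G'. mds_form tens M I G G' = cinner G (Msq G')"
  shows "Msq G = 0 \<longleftrightarrow> (\<forall>y. M (tens G y) = 0)"
proof
  assume "Msq G = 0"
  then have "(\<Sum>\<^sub>\<infinity>e\<in>I. cinner (M (tens G e)) (M (tens G e))) = 0"
    using Msq unfolding mds_form_def by simp
  then have zeroC: "(\<Sum>\<^sub>\<infinity>e\<in>I. complex_of_real ((norm (M (tens G e)))\<^sup>2)) = 0"
    unfolding cinner_self .
  have summable: "(\<lambda>e. (norm (M (tens G e)))\<^sup>2) summable_on I"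
    using I by (intro hilbert_schmidt_tens_summable[OF tens M]) (simp add: orthonormal_basis_def)
  then have "((\<lambda>e. complex_of_real ((norm (M (tens G e)))\<^sup>2)) has_sum
      complex_of_real (\<Sum>\<^sub>\<infinity>e\<in>I. (norm (M (tens G e)))\<^sup>2)) I"
    \<comment> \<open>The vanishing complex sum is carried over to the real one, where nonnegativity
      forces every term to be 0.\<close>
    by (simp only: has_sum_of_real_iff has_sum_infsum)
  with infsumI have sum0: "(\<Sum>\<^sub>\<infinity>e\<in>I. (norm (M (tens G e)))\<^sup>2) = 0"
    using zeroC by (metis of_real_eq_0_iff)
  have zero: "M (tens G e) = 0" if "e \<in> I" for e
    using nonneg_infsum_le_0D[of "\<lambda>e. (norm (M (tens G e)))\<^sup>2" I e] summable sum0 that by simp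
  have lin: "bounded_linear (\<lambda>y. M (tens G y))"
    using M by (intro bounded_linear_compose[OF _ hilbert_tensor_bounded_linear_right[OF tens]])
      (simp add: hilbert_schmidt_def bounded_clinear_def)
  show "\<forall>y. M (tens G y) = 0"
  proof
    fix y
    show "M (tens G y) = 0"
    proof (rule eq_on_dense_imp_eq[where f = "\<lambda>y. M (tens G y)" and g = "\<lambda>_. 0"])
      show "continuous_on UNIV (\<lambda>y. M (tens G y))"
        using lin by (rule linear_continuous_on)
      show "closure (span I) = UNIV"
        using I by (simp add: orthonormal_basis_def)
      show "M (tens G y) = 0" if "y \<in> span I" for y
        using linear_eq_0_on_span[OF bounded_linear.linear[OF lin] zero that] .
    qed simp
  qed
next
  assume "\<forall>y. M (tens G y) = 0"
  \<comment> \<open>This is the form evaluated at \<open>Msq G\<close> and G: each summand contains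
    a factor \<open>M (tens G e)\<close>.\<close>
  then have "cinner (Msq G) (Msq G) = 0"
    unfolding Msq[rule_format, symmetric] mds_form_def by simp
  then show "Msq G = 0"
    by (simp add: cinner_eq_zero_iff)
qed

section \<open>The scalar component\<close>

text \<open>The only list of length 0 is \<open>[]\<close>, so every admissible E contributes the
  same value. The empty E ensures that the supremum is not over the empty set.\<close>

lemma cross_norm_degree_0: "cross_norm X m 0 t = cmod (t [])"
proof -
  have "{es. set es \<subseteq> E \<and> length es = 0} = {[]}" for E :: "'a set"
    by auto
  moreover have "{} \<in> {E. finite E \<and> E \<subseteq> pts X \<and> orthonormal (hip X m) E}"
    by (simp add: orthonormal_def)
  then have "{E. finite E \<and> E \<subseteq> pts X \<and> orthonormal (hip X m) E} \<noteq> {}"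
    by blast
  ultimately show ?thesis
    by (simp add: cross_norm_def)
qed

lemma cross_norm_zero: "cross_norm X m n 0 = 0"
proof -
  have "{E. finite E \<and> E \<subseteq> pts X \<and> orthonormal (hip X m) E} \<noteq> {}"
    by (auto simp: orthonormal_def intro!: exI[of _ "{}"])
  then show ?thesis
    by (simp add: cross_norm_def)
qed

lemma pure_tensor_Nil: "pure_tensor X [] = unit_tensor 0"
  by (auto simp: pure_tensor_def unit_tensor_def fun_eq_iff)

lemma alg_tensor_power_0_scalar: "(\<lambda>\<phi>s. c * unit_tensor 0 \<phi>s) \<in> alg_tensor_power X 0"
  unfolding alg_tensor_power_def
  by (rule CollectI, intro exI[of _ "1::nat"] exI[of _ "\<lambda>_. c"] exI[of _ "\<lambda>_. []"])
    (simp add: pure_tensor_Nil)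

lemma alg_tensor_power_0_support:
  assumes "t \<in> alg_tensor_power X 0" "\<phi>s \<noteq> []"
  shows "t \<phi>s = 0"
  using assms by (auto simp: alg_tensor_power_def pure_tensor_Nil unit_tensor_def)

text \<open>Support in \<open>[]\<close> survives pointwise limits, and conversely a constant
  sequence suffices. Hence degree 0 can be changed freely within the tensor algebra.\<close>

lemma tensor_power_0:
  "tensor_power X 0 = {t. \<forall>\<phi>s. \<phi>s \<noteq> [] \<longrightarrow> t \<phi>s = 0}"
proof (intro equalityI subsetI)
  fix t assume "t \<in> tensor_power X 0"
  then obtain a where a: "range a \<subseteq> alg_tensor_power X 0" "\<And>\<phi>s. (\<lambda>k. a k \<phi>s) \<longlonglongrightarrow> t \<phi>s"
    by (auto simp: tensor_power_def)
  have "t \<phi>s = 0" if "\<phi>s \<noteq> []" for \<phi>s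
  proof -
    have "(\<lambda>k. a k \<phi>s) = (\<lambda>_. 0)"
      using a(1) alg_tensor_power_0_support that by blast
    with a(2)[of \<phi>s] show ?thesis
      by (simp add: LIMSEQ_const_iff)
  qed
  then show "t \<in> {t. \<forall>\<phi>s. \<phi>s \<noteq> [] \<longrightarrow> t \<phi>s = 0}" by simp
next
  fix t :: "'a tensor" assume "t \<in> {t. \<forall>\<phi>s. \<phi>s \<noteq> [] \<longrightarrow> t \<phi>s = 0}"
  then have "t = (\<lambda>\<phi>s. t [] * unit_tensor 0 \<phi>s)"
    by (auto simp: unit_tensor_def fun_eq_iff)
  then have "t \<in> alg_tensor_power X 0"
    by (metis alg_tensor_power_0_scalar)
  then show "t \<in> tensor_power X 0"
    unfolding tensor_power_def
    by (intro CollectI exI[of _ "\<lambda>_. t"]) (auto simp: cross_norm_zero)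
qed

lemma zero_in_tensor_power: "0 \<in> tensor_power X n"
proof -
  have "0 \<in> alg_tensor_power X n"
    unfolding alg_tensor_power_def
    by (rule CollectI, intro exI[of _ "0::nat"] exI) (simp add: zero_fun_def)
  then show ?thesis
    unfolding tensor_power_def
    by (intro CollectI exI[of _ "\<lambda>_. 0"]) (auto simp: cross_norm_zero)
qed

lemma sym_proj_zero: "sym_proj T n 0 = 0"
  by (simp add: sym_proj_def perm_action_def zero_fun_def cong: if_cong)

text \<open>Only the identity permutation and the empty list of sectors occur, with sign 1.\<close>

lemma sym_proj_degree_0:
  assumes "\<And>\<phi>s. \<phi>s \<noteq> [] \<Longrightarrow> t \<phi>s = 0"
  shows "sym_proj T 0 t = t"
proof
  fix \<phi>s
  have "{as. as = [] \<and> P as} = (if P [] then {[]} else {})" for P :: "nat list \<Rightarrow> bool"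
    by auto
  moreover have "{as. set as \<subseteq> {..<nsec T} \<and> as = []} = {[]}"
    by auto
  moreover have "perm_parity 0 \<pi> as i = 0" for \<pi> as i
    by (simp add: perm_parity_def)
  ultimately show "sym_proj T 0 t \<phi>s = t \<phi>s"
    using assms by (cases "\<phi>s = []") (simp_all add: sym_proj_def perm_action_def)
qed

lemma tensor_algebra_change_scalar:
  assumes G: "G \<in> tensor_algebra X" and t: "\<And>\<phi>s. \<phi>s \<noteq> [] \<Longrightarrow> t \<phi>s = 0"
  shows "G(0 := t) \<in> tensor_algebra X"
proof -
  have "(G(0 := t)) n \<in> tensor_power X n" for n
    using assms by (cases "n = 0") (simp_all add: tensor_algebra_def tensor_power_0)
  moreover have "summable (\<lambda>n. 2 ^ (m * n) * (cross_norm X m n ((G(0 := t)) n))\<^sup>2)" for m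
    \<comment> \<open>Dropping the degree 0 term leaves the series of G.\<close>
    using G by (subst summable_Suc_iff[symmetric])
      (simp del: mult_Suc_right power_mult_distrib
        add: tensor_algebra_def summable_Suc_iff[of "\<lambda>n. 2 ^ (m * n) * (cross_norm X m n (G n))\<^sup>2"])
  ultimately show ?thesis
    by (simp add: tensor_algebra_def)
qed

text \<open>The weight \<open>2 ^ (m * n)\<close> is 1 in degree 0, so the scalar part enters in the
  same way for every m.\<close>

lemma ta_norm_sq:
  assumes "G \<in> tensor_algebra X"
  shows "(ta_norm X m G)\<^sup>2 = (cmod (scalar_component G))\<^sup>2
    + (\<Sum>n. 2 ^ (m * Suc n) * (cross_norm X m (Suc n) (G (Suc n)))\<^sup>2)"
proof -
  let ?f = "\<lambda>n. 2 ^ (m * n) * (cross_norm X m n (G n))\<^sup>2"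
  have s: "summable ?f"
    using assms by (simp add: tensor_algebra_def)
  then have "(ta_norm X m G)\<^sup>2 = suminf ?f"
    by (simp add: ta_norm_def suminf_nonneg)
  also have "\<dots> = (\<Sum>n. ?f (Suc n)) + ?f 0"
    using suminf_split_head[OF s] by simp
  finally show ?thesis
    by (simp add: cross_norm_degree_0 scalar_component_def)
qed

section \<open>The unit and its scalar product with the field algebra\<close>

lemma add_unit_tensor:
  fixes G :: "nat \<Rightarrow> 'x::ab_group_add tensor"
  shows "G + cscale c unit_tensor = G(0 := \<lambda>\<phi>s. G 0 \<phi>s + c * unit_tensor 0 \<phi>s)"
  by (auto simp: cscale_def unit_tensor_def fun_eq_iff)

lemma field_algebra_add_unit:
  assumes "G \<in> field_algebra T"
  shows "G + cscale c unit_tensor \<in> field_algebra T"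
proof -
  have "G 0 \<in> tensor_power (cfields T) 0"
    using assms by (simp add: field_algebra_def tensor_algebra_def)
  then have 0: "G 0 \<phi>s + c * unit_tensor 0 \<phi>s = 0" if "\<phi>s \<noteq> []" for \<phi>s
    using that by (simp add: tensor_power_0 unit_tensor_def)
  with assms show ?thesis
    unfolding add_unit_tensor field_algebra_def
    by (auto intro!: tensor_algebra_change_scalar sym_proj_degree_0)
qed

lemma cscale_unit_in_field_algebra: "cscale c unit_tensor \<in> field_algebra T"
proof -
  have "0 \<in> field_algebra T"
    by (simp add: field_algebra_def tensor_algebra_def zero_in_tensor_power cross_norm_zero sym_proj_zero)
  from field_algebra_add_unit[OF this, of c] show ?thesis
    by simp
qed

lemma unit_tensor_in_field_algebra: "unit_tensor \<in> field_algebra T"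
  using cscale_unit_in_field_algebra[of 1 T] by (simp add: cscale_def)

lemma ta_norm_add_unit:
  assumes "G \<in> field_algebra T"
  shows "(ta_norm (cfields T) m (G + cscale c unit_tensor))\<^sup>2
    = (ta_norm (cfields T) m G)\<^sup>2 - (cmod (scalar_component G))\<^sup>2 + (cmod (scalar_component G + c))\<^sup>2"
proof -
  have "G \<in> tensor_algebra (cfields T)" "G + cscale c unit_tensor \<in> tensor_algebra (cfields T)"
    using assms field_algebra_add_unit[OF assms, of c] by (simp_all add: field_algebra_def)
  moreover have "scalar_component (G + cscale c unit_tensor) = scalar_component G + c"
    by (simp add: scalar_component_def cscale_def unit_tensor_def)
  moreover have "(G + cscale c unit_tensor) (Suc n) = G (Suc n)" for n
    by (simp add: add_unit_tensor)
  ultimately show ?thesis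
    by (simp add: ta_norm_sq)
qed

lemma cinner_unit_eq_scalar_component:
  assumes \<eta>: "tensor_completion (field_algebra T) (ta_norm (cfields T) m) \<eta>"
    and G: "G \<in> field_algebra T"
  shows "cinner (\<eta> unit_tensor) (\<eta> G) = scalar_component G"
proof -
  have norm: "(norm (\<eta> G + scaleC c (\<eta> unit_tensor)))\<^sup>2
      = (ta_norm (cfields T) m G)\<^sup>2 - (cmod (scalar_component G))\<^sup>2 + (cmod (scalar_component G + c))\<^sup>2"
    for c
  proof -
    have "\<eta> (G + cscale c unit_tensor) = \<eta> G + scaleC c (\<eta> unit_tensor)"
      using \<eta> G by (auto simp: tensor_completion_def unit_tensor_in_field_algebra cscale_unit_in_field_algebra)
    then have "norm (\<eta> G + scaleC c (\<eta> unit_tensor)) = ta_norm (cfields T) m (G + cscale c unit_tensor)"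
      using \<eta> field_algebra_add_unit[OF G, of c] by (metis tensor_completion_def)
    then show ?thesis
      by (simp add: ta_norm_add_unit[OF G])
  qed
  show ?thesis
    \<comment> \<open>The terms independent of c cancel, leaving the polarization identity of the
      complex plane for the number \<open>scalar_component G\<close>.\<close>
    unfolding cinner_polarization norm
    by (simp add: complex_eq_iff cmod_power2) (simp add: power2_eq_square algebra_simps)
qed

lemma scalar_component_extension_eq_cinner:
  assumes \<eta>: "tensor_completion (field_algebra T) (ta_norm (cfields T) m) \<eta>"
    and b: "bounded_clinear b" "\<forall>G \<in> field_algebra T. b (\<eta> G) = scalar_component G"
  shows "b x = cinner (\<eta> unit_tensor) x"
proof (rule eq_on_dense_imp_eq[where f = b])
  show "continuous_on UNIV b"
    using b(1) by (simp add: bounded_clinear_def linear_continuous_on)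
  show "closure (\<eta> ` field_algebra T) = UNIV"
    using \<eta> by (simp add: tensor_completion_def)
  show "b x = cinner (\<eta> unit_tensor) x" if "x \<in> \<eta> ` field_algebra T" for x
    using that b(2) cinner_unit_eq_scalar_component[OF \<eta>] by auto
qed (rule continuous_on_cinner_right)

theorem theorem33:
  fixes T :: "('i::finite, 'p::t2_space, 'd::finite, 'v::euclidean_space) field_theory"
    and \<psi>\<^sub>0 :: "('i, 'p, 'v) sec"
    and EE :: "(nat \<Rightarrow> ('i, 'p, 'v) csec tensor) \<Rightarrow> ('i, 'p, 'v) sec \<Rightarrow> complex"
    and m n :: nat
    and \<eta>m :: "(nat \<Rightarrow> ('i, 'p, 'v) csec tensor) \<Rightarrow> 'hm::complex_hilbert"
    and \<eta>0 :: "(nat \<Rightarrow> ('i, 'p, 'v) csec tensor) \<Rightarrow> 'h0::complex_hilbert"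
    and \<eta>F :: "('i, 'p, 'v) sec \<Rightarrow> 'fn::{real_inner, complete_space}"
    and tens :: "'hm \<Rightarrow> 'fn \<Rightarrow> 't::complex_hilbert"
    and M :: "'t \<Rightarrow> 'h0"
    and b :: "'hm \<Rightarrow> complex"
    and I :: "'fn set"
    and Msq P :: "'hm \<Rightarrow> 'hm"
  assumes "regularized_field_theory T"
    and "\<psi>\<^sub>0 \<in> affine_sections T"
    and "represents_EL T \<psi>\<^sub>0 EE"
    \<comment> \<open>the Hilbert spaces \<open>H\<^sub>m\<close>, \<open>H\<^sub>0\<close>, \<open>F\<^sub>n\<close> and the tensor product of \<open>H\<^sub>m\<close> and \<open>F\<^sub>n\<close>\<close>
    and "tensor_completion (field_algebra T) (ta_norm (cfields T) m) \<eta>m"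
    and "tensor_completion (field_algebra T) (ta_norm (cfields T) 0) \<eta>0"
    and "real_completion (test T) (ip_norm (tip T n)) \<eta>F"
    and "hilbert_tensor tens"
    \<comment> \<open>the Hilbert--Schmidt extension of the regularized MDS operator\<close>
    and "hilbert_schmidt M"
    and "\<forall>G \<in> field_algebra T. \<forall>\<delta> \<in> test T. M (tens (\<eta>m G) (\<eta>F \<delta>)) = \<eta>0 (mds_operator T EE G \<delta>)"
    \<comment> \<open>the continuous extension of the scalar component map\<close>
    and "bounded_clinear b"
    and "\<forall>G \<in> field_algebra T. b (\<eta>m G) = scalar_component G"
    \<comment> \<open>the positive operator associated with \<open>M\<close>, and the projection onto its kernel\<close>
    and "orthonormal_basis I"
    and "bounded_clinear Msq"
    and "\<forall>G G'. mds_form tens M I G G' = cinner G (Msq G')"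
    and "orthogonal_projection P {G. Msq G = 0}"
  shows "((\<exists>G. b G = 1 \<and> (\<forall>\<delta> \<in> test T. M (tens G (\<eta>F \<delta>)) = 0)) \<longleftrightarrow> P (\<eta>m unit_tensor) \<noteq> 0) \<and>
    (P (\<eta>m unit_tensor) \<noteq> 0 \<longleftrightarrow> b (P (\<eta>m unit_tensor)) \<noteq> 0)"
proof -
  note tens = \<open>hilbert_tensor tens\<close> and M = \<open>hilbert_schmidt M\<close>
  let ?u = "\<eta>m unit_tensor"
  have b: "b x = cinner ?u x" for x
    by (rule scalar_component_extension_eq_cinner) fact+
  have P: "orthogonal_projection P {G. Msq G = 0}"
    by fact
  have ker: "Msq G = 0 \<longleftrightarrow> (\<forall>\<delta> \<in> test T. M (tens G (\<eta>F \<delta>)) = 0)" for G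
  proof -
    \<comment> \<open>Test fields are dense in the completion, so by continuity the equation extends
      to all y, as \<open>kernel_mds_form\<close> requires.\<close>
    have "M (tens G y) = 0" if "\<forall>\<delta> \<in> test T. M (tens G (\<eta>F \<delta>)) = 0" for y
    proof (rule eq_on_dense_imp_eq[where f = "\<lambda>y. M (tens G y)" and g = "\<lambda>_. 0"])
      have "bounded_linear (\<lambda>y. M (tens G y))"
        using M by (intro bounded_linear_compose[OF _ hilbert_tensor_bounded_linear_right[OF tens]])
          (simp add: hilbert_schmidt_def bounded_clinear_def)
      then show "continuous_on UNIV (\<lambda>y. M (tens G y))"
        by (rule linear_continuous_on)
      show "closure (\<eta>F ` test T) = UNIV"
        using \<open>real_completion (test T) (ip_norm (tip T n)) \<eta>F\<close> by (simp add: real_completion_def)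
    qed (use that in auto)
    moreover have "Msq G = 0 \<longleftrightarrow> (\<forall>y. M (tens G y) = 0)"
      by (rule kernel_mds_form[OF tens M]) fact+
    ultimately show ?thesis by blast
  qed
  have bP: "b (P ?u) = complex_of_real ((norm (P ?u))\<^sup>2)"
    unfolding b by (rule orthogonal_projection_cinner[OF P])
  \<comment> \<open>If the projection of the unit were 0, the unit would be orthogonal to the kernel
    and b would vanish there.\<close>
  have "P ?u \<noteq> 0" if "b G = 1" "Msq G = 0" for G
    using orthogonal_projection_eq_zeroD[OF P, of ?u G] that by (auto simp: b)
  moreover have "\<exists>G. b G = 1 \<and> Msq G = 0" if "P ?u \<noteq> 0"
  proof (intro exI conjI)
    \<comment> \<open>The projected unit lies in the kernel, and its scalar component is its squared
      norm; dividing by that gives a solution.\<close>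
    let ?G = "scaleC (1 / b (P ?u)) (P ?u)"
    show "b ?G = 1"
      using that bP by (simp add: b cinner_scaleC_right)
    have "Msq (P ?u) = 0"
      using P unfolding orthogonal_projection_def by blast
    moreover have "Msq (scaleC z x) = scaleC z (Msq x)" for z x
      using \<open>bounded_clinear Msq\<close> by (simp add: bounded_clinear_def)
    moreover have "scaleC z (0::'hm) = 0" for z
      using scaleC_add_right[of z 0 "0::'hm"] by simp
    ultimately show "Msq ?G = 0" by simp
  qed
  ultimately show ?thesis
    unfolding ker[symmetric] using bP by auto
qed

end
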